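(* Let $(w_j)_{j\ge 0}$ be a sequence of real numbers with $w_j>0$ for all $j$, $\liminf_{j} |w_j|^{1/j}=1$, and $\sup_j \frac{w_{j+1}}{w_j}<\infty$. Let $T$ be the backward shift operator on the space $$H^2_w=\Big\{f=\sum_{j=0}^{\infty} a_jz^j : \sum_{j=0}^{\infty} |a_j|^2w_j < \infty\Big\}.$$ Let $n$ be a positive integer. If $T$ is an $n$-hypercontraction, then for every nonnegative integer $j$, $$\frac{w_{j+1}}{w_j}\le \frac{1+j}{n+j}.$$
   Context: $H^2_w$ is a Hilbert space with norm $\|f\|^2=\sum_{j=0}^\infty |a_j|^2 w_j$ for $f=\sum_j a_jz^j$ (so the monomials $z^j$ are orthogonal with $\|z^j\|^2=w_j$). The backward shift operator on $H^2_w$ is the adjoint of the (bounded) forward shift $f(z)\mapsto zf(z)$; explicitly, $$T\Big(\sum_{j=0}^\infty a_jz^j\Big)=\sum_{j=0}^\infty \frac{w_{j+1}}{w_j}a_{j+1}z^j .$$ For a positive integer $n$, a bounded linear operator $T$ on a Hilbert space is an $n$-hypercontraction if $$\sum_{j=0}^k(-1)^j\binom{k}{j}(T^* )^jT^j\ge 0\quad\text{for all } 1\le k\le n.$$ *)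

theory Defs
  imports "HOL-Analysis.Analysis"
begin

section \<open>Operators on complex Hilbert spaces\<close>

text \<open>
  The Hilbert space varies with a weight sequence, so it is given by a carrier
  \<open>H\<close> inside a fixed complex vector space and an inner product \<open>ip\<close> on it
  (linear in the first argument).
\<close>

definition ip_norm :: "('a \<Rightarrow> 'a \<Rightarrow> complex) \<Rightarrow> 'a \<Rightarrow> real" where
  "ip_norm ip x = sqrt (Re (ip x x))"

locale complex_hilbert_space = vector_space smul
  for smul :: "complex \<Rightarrow> 'a::ab_group_add \<Rightarrow> 'a" +
  fixes H :: "'a set" and ip :: "'a \<Rightarrow> 'a \<Rightarrow> complex"
  assumes subspace_carrier: "subspace H"
    and ip_add: "\<lbrakk>x \<in> H; y \<in> H; z \<in> H\<rbrakk> \<Longrightarrow> ip (x + y) z = ip x z + ip y z"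
    and ip_scale: "\<lbrakk>x \<in> H; y \<in> H\<rbrakk> \<Longrightarrow> ip (smul c x) y = c * ip x y"
    and ip_cnj: "\<lbrakk>x \<in> H; y \<in> H\<rbrakk> \<Longrightarrow> ip y x = cnj (ip x y)"
    and ip_nonneg: "x \<in> H \<Longrightarrow> ip x x \<in> \<real>\<^sub>\<ge>\<^sub>0"
    and ip_definite: "\<lbrakk>x \<in> H; ip x x = 0\<rbrakk> \<Longrightarrow> x = 0"
    and complete_carrier:
      "\<lbrakk>\<And>i. X i \<in> H; \<And>e. e > 0 \<Longrightarrow> \<exists>N. \<forall>m\<ge>N. \<forall>n\<ge>N. ip_norm ip (X m - X n) < e\<rbrakk>
        \<Longrightarrow> \<exists>x\<in>H. (\<lambda>i. ip_norm ip (X i - x)) \<longlonglongrightarrow> 0"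

definition bounded_operator_on ::
    "(complex \<Rightarrow> 'a::ab_group_add \<Rightarrow> 'a) \<Rightarrow> 'a set \<Rightarrow> ('a \<Rightarrow> 'a \<Rightarrow> complex) \<Rightarrow> ('a \<Rightarrow> 'a) \<Rightarrow> bool" where
  "bounded_operator_on smul H ip T \<longleftrightarrow>
     (\<forall>x\<in>H. T x \<in> H) \<and>
     (\<forall>x\<in>H. \<forall>y\<in>H. T (x + y) = T x + T y) \<and>
     (\<forall>c. \<forall>x\<in>H. T (smul c x) = smul c (T x)) \<and>
     (\<exists>B. \<forall>x\<in>H. ip_norm ip (T x) \<le> B * ip_norm ip x)"

text \<open>As for the library constant \<^const>\<open>adjoint\<close>, by choice; the result is determined only on \<open>H\<close>.\<close>

definition adjoint_on :: "'a set \<Rightarrow> ('a \<Rightarrow> 'a \<Rightarrow> complex) \<Rightarrow> ('a \<Rightarrow> 'a) \<Rightarrow> 'a \<Rightarrow> 'a" where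
  "adjoint_on H ip T =
     (SOME S. (\<forall>y\<in>H. S y \<in> H) \<and> (\<forall>x\<in>H. \<forall>y\<in>H. ip (T x) y = ip x (S y)))"

definition positive_operator_on :: "'a set \<Rightarrow> ('a \<Rightarrow> 'a \<Rightarrow> complex) \<Rightarrow> ('a \<Rightarrow> 'a) \<Rightarrow> bool" where
  "positive_operator_on H ip A \<longleftrightarrow> (\<forall>x\<in>H. ip (A x) x \<in> \<real>\<^sub>\<ge>\<^sub>0)"

definition hypercontraction ::
    "nat \<Rightarrow> (complex \<Rightarrow> 'a::ab_group_add \<Rightarrow> 'a) \<Rightarrow> 'a set \<Rightarrow> ('a \<Rightarrow> 'a \<Rightarrow> complex) \<Rightarrow> ('a \<Rightarrow> 'a) \<Rightarrow> bool" where
  "hypercontraction n smul H ip T \<longleftrightarrow>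
     bounded_operator_on smul H ip T \<and>
     (\<forall>k. 1 \<le> k \<and> k \<le> n \<longrightarrow>
        positive_operator_on H ip
          (\<lambda>x. \<Sum>j\<le>k. smul ((- 1) ^ j * of_nat (k choose j))
                            ((adjoint_on H ip T ^^ j) ((T ^^ j) x))))"

section \<open>Weighted Hardy spaces\<close>

text \<open>Elements are power series, identified with their coefficient sequences.\<close>

definition fps_scale :: "complex \<Rightarrow> complex fps \<Rightarrow> complex fps" where
  "fps_scale c f = fps_const c * f"

definition H2 :: "(nat \<Rightarrow> real) \<Rightarrow> complex fps set" where
  "H2 w = {f. summable (\<lambda>j. (cmod (fps_nth f j))\<^sup>2 * w j)}"

definition H2_inner :: "(nat \<Rightarrow> real) \<Rightarrow> complex fps \<Rightarrow> complex fps \<Rightarrow> complex" where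
  "H2_inner w f g = (\<Sum>j. fps_nth f j * cnj (fps_nth g j) * complex_of_real (w j))"

definition forward_shift :: "complex fps \<Rightarrow> complex fps" where
  "forward_shift f = fps_X * f"

text \<open>The explicit form of the adjoint of \<open>forward_shift\<close>; see \<open>adjoint_forward_shift\<close> below.\<close>

definition backward_shift :: "(nat \<Rightarrow> real) \<Rightarrow> complex fps \<Rightarrow> complex fps" where
  "backward_shift w f = Abs_fps (\<lambda>j. complex_of_real (w (Suc j) / w j) * fps_nth f (Suc j))"

section \<open>Basic facts\<close>

lemma fps_scale_nth [simp]: "fps_nth (fps_scale c f) j = c * fps_nth f j"
  by (simp add: fps_scale_def)

lemma forward_shift_nth:
  "fps_nth (forward_shift f) j = (if j = 0 then 0 else fps_nth f (j - 1))"
  by (simp add: forward_shift_def)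

lemma backward_shift_nth [simp]:
  "fps_nth (backward_shift w f) j = complex_of_real (w (Suc j) / w j) * fps_nth f (Suc j)"
  by (simp add: backward_shift_def)

lemma vector_space_fps_scale: "vector_space fps_scale"
  by unfold_locales (auto simp: fps_eq_iff algebra_simps)

context
  fixes w :: "nat \<Rightarrow> real"
  assumes w_pos: "\<And>j. w j > 0"
begin

lemma H2_add: 
  assumes "f \<in> H2 w" "g \<in> H2 w"
  shows "f + g \<in> H2 w"
proof -
  have "summable (\<lambda>j. 2 * ((cmod (fps_nth f j))\<^sup>2 * w j) + 2 * ((cmod (fps_nth g j))\<^sup>2 * w j))"
    using assms by (intro summable_add summable_mult) (auto simp: H2_def)
  moreover have "norm ((cmod (fps_nth (f + g) j))\<^sup>2 * w j)
      \<le> 2 * ((cmod (fps_nth f j))\<^sup>2 * w j) + 2 * ((cmod (fps_nth g j))\<^sup>2 * w j)" for j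
  proof -
    have "(cmod (fps_nth (f + g) j))\<^sup>2 \<le> (cmod (fps_nth f j) + cmod (fps_nth g j))\<^sup>2"
      by (simp add: power_mono norm_triangle_ineq)
    also have "\<dots> \<le> 2 * (cmod (fps_nth f j))\<^sup>2 + 2 * (cmod (fps_nth g j))\<^sup>2"
      using sum_squares_bound[of "cmod (fps_nth f j)" "cmod (fps_nth g j)"]
      by (simp add: power2_sum)
    finally show ?thesis
      using w_pos[of j] mult_right_mono[of _ _ "w j"]
      by (fastforce simp: algebra_simps abs_mult)
  qed
  ultimately show ?thesis
    unfolding H2_def by (blast intro: summable_comparison_test')
qed

lemma H2_scale:
  assumes "f \<in> H2 w"
  shows "fps_scale c f \<in> H2 w"
proof -
  have "summable (\<lambda>j. (cmod c)\<^sup>2 * ((cmod (fps_nth f j))\<^sup>2 * w j))"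
    using assms by (intro summable_mult) (auto simp: H2_def)
  thus ?thesis
    by (simp add: H2_def norm_mult power_mult_distrib mult_ac)
qed

lemma H2_zero: "0 \<in> H2 w"
  by (simp add: H2_def)

lemma H2_diff:
  assumes "f \<in> H2 w" "g \<in> H2 w"
  shows "f - g \<in> H2 w"
proof -
  have "f - g = f + fps_scale (- 1) g"
    by (simp add: fps_eq_iff)
  thus ?thesis
    using H2_add H2_scale assms by metis
qed

lemma H2_inner_summable:
  assumes "f \<in> H2 w" "g \<in> H2 w"
  shows "summable (\<lambda>j. fps_nth f j * cnj (fps_nth g j) * complex_of_real (w j))"
proof -
  have "summable (\<lambda>j. (cmod (fps_nth f j))\<^sup>2 * w j + (cmod (fps_nth g j))\<^sup>2 * w j)"
    using assms by (intro summable_add) (auto simp: H2_def)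
  moreover have "norm (fps_nth f j * cnj (fps_nth g j) * complex_of_real (w j))
      \<le> (cmod (fps_nth f j))\<^sup>2 * w j + (cmod (fps_nth g j))\<^sup>2 * w j" for j
  proof -
    have "cmod (fps_nth f j) * cmod (fps_nth g j) \<le> (cmod (fps_nth f j))\<^sup>2 + (cmod (fps_nth g j))\<^sup>2"
      using sum_squares_bound[of "cmod (fps_nth f j)" "cmod (fps_nth g j)"]
        zero_le_power2[of "cmod (fps_nth f j)"] zero_le_power2[of "cmod (fps_nth g j)"]
      by linarith
    from mult_right_mono[OF this, of "w j"] show ?thesis
      using w_pos[of j] by (simp add: norm_mult distrib_right)
  qed
  ultimately show ?thesis
    by (blast intro: summable_comparison_test')
qed

lemma H2_inner_self:
  assumes "f \<in> H2 w"
  shows "H2_inner w f f = complex_of_real (\<Sum>j. (cmod (fps_nth f j))\<^sup>2 * w j)"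
proof -
  have "H2_inner w f f = (\<Sum>j. complex_of_real ((cmod (fps_nth f j))\<^sup>2 * w j))"
    unfolding H2_inner_def by (simp add: complex_norm_square del: of_real_power)
  also have "\<dots> = complex_of_real (\<Sum>j. (cmod (fps_nth f j))\<^sup>2 * w j)"
    using assms by (intro suminf_of_real [symmetric]) (simp add: H2_def)
  finally show ?thesis .
qed

lemma H2_norm:
  assumes "f \<in> H2 w"
  shows "ip_norm (H2_inner w) f = sqrt (\<Sum>j. (cmod (fps_nth f j))\<^sup>2 * w j)"
  using assms by (simp add: ip_norm_def H2_inner_self)

lemma H2_norm_less_imp:
  assumes "f \<in> H2 w" "ip_norm (H2_inner w) f < e" 
  shows "(\<Sum>j\<in>J. (cmod (fps_nth f j))\<^sup>2 * w j) \<le> e\<^sup>2"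
proof (cases "finite J")
  case True
  have nn: "0 \<le> (cmod (fps_nth f j))\<^sup>2 * w j" for j
    using w_pos[of j] by simp
  have "(\<Sum>j\<in>J. (cmod (fps_nth f j))\<^sup>2 * w j) \<le> (\<Sum>j. (cmod (fps_nth f j))\<^sup>2 * w j)"
    using assms(1) True nn by (intro sum_le_suminf) (auto simp: H2_def)
  also have "\<dots> = (sqrt (\<Sum>j. (cmod (fps_nth f j))\<^sup>2 * w j))\<^sup>2"
    using assms(1) nn by (simp add: suminf_nonneg H2_def)
  also have "\<dots> \<le> e\<^sup>2"
    using assms H2_norm nn
    by (intro power_mono) (auto simp: suminf_nonneg H2_def)
  finally show ?thesis .
qed simp

lemma H2_complete:
  assumes X: "\<And>i. X i \<in> H2 w"
    and Cauchy: "\<And>e. e > 0 \<Longrightarrow> \<exists>N. \<forall>m\<ge>N. \<forall>n\<ge>N. ip_norm (H2_inner w) (X m - X n) < e"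
  shows "\<exists>f\<in>H2 w. (\<lambda>i. ip_norm (H2_inner w) (X i - f)) \<longlonglongrightarrow> 0"
proof -
  have "Cauchy (\<lambda>i. fps_nth (X i) j)" for j
  proof (rule metric_CauchyI)
    fix e :: real assume e: "e > 0"
    define d where "d = e / 2 * sqrt (w j)"
    have "d > 0" using e w_pos[of j] by (simp add: d_def)
    then obtain N where N: "\<And>m n. m \<ge> N \<Longrightarrow> n \<ge> N \<Longrightarrow> ip_norm (H2_inner w) (X m - X n) < d"
      using Cauchy by blast
    have "dist (fps_nth (X m) j) (fps_nth (X n) j) < e" if "m \<ge> N" "n \<ge> N" for m n
    proof -
      have "(cmod (fps_nth (X m - X n) j))\<^sup>2 * w j \<le> d\<^sup>2"
        using H2_norm_less_imp[OF H2_diff[OF X X] N[OF that], of "{j}"] by simp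
      also have "d\<^sup>2 = (e / 2)\<^sup>2 * w j"
        using w_pos[of j] by (simp add: d_def power_mult_distrib power_divide)
      finally have "(cmod (fps_nth (X m - X n) j))\<^sup>2 \<le> (e / 2)\<^sup>2"
        using w_pos[of j] mult_le_cancel_right_pos by blast
      hence "cmod (fps_nth (X m - X n) j) \<le> e / 2"
        by (rule power2_le_imp_le) (use e in simp)
      thus ?thesis using e by (simp add: dist_norm)
    qed
    thus "\<exists>M. \<forall>m\<ge>M. \<forall>n\<ge>M. dist (fps_nth (X m) j) (fps_nth (X n) j) < e"
      by blast
  qed
  hence "\<forall>j. \<exists>l. (\<lambda>i. fps_nth (X i) j) \<longlonglongrightarrow> l"
    using Cauchy_convergent convergent_def by blast
  then obtain l where l: "\<And>j. (\<lambda>i. fps_nth (X i) j) \<longlonglongrightarrow> l j"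
    by metis
  define f where "f = Abs_fps l"
  have key: "X m - f \<in> H2 w \<and> ip_norm (H2_inner w) (X m - f) \<le> e"
    if e: "e > 0" and N: "\<And>n. n \<ge> N \<Longrightarrow> ip_norm (H2_inner w) (X m - X n) < e" for m e N
  proof -
    have bd: "(\<Sum>j<K. (cmod (fps_nth (X m - f) j))\<^sup>2 * w j) \<le> e\<^sup>2" for K
    proof (rule tendsto_upperbound)
      show "(\<lambda>n. \<Sum>j<K. (cmod (fps_nth (X m - X n) j))\<^sup>2 * w j)
              \<longlonglongrightarrow> (\<Sum>j<K. (cmod (fps_nth (X m - f) j))\<^sup>2 * w j)"
        unfolding f_def by (auto intro!: tendsto_intros l)
      show "\<forall>\<^sub>F n in sequentially. (\<Sum>j<K. (cmod (fps_nth (X m - X n) j))\<^sup>2 * w j) \<le> e\<^sup>2"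
        using H2_norm_less_imp[OF H2_diff[OF X X] N]
        by (auto simp: eventually_sequentially)
    qed simp
    have nn: "0 \<le> (cmod (fps_nth (X m - f) j))\<^sup>2 * w j" for j
      using w_pos[of j] by simp
    have sm: "summable (\<lambda>j. (cmod (fps_nth (X m - f) j))\<^sup>2 * w j)"
      using bd nn by (intro summableI_nonneg_bounded) 
    hence mem: "X m - f \<in> H2 w" by (simp add: H2_def)
    have "(\<Sum>j. (cmod (fps_nth (X m - f) j))\<^sup>2 * w j) \<le> e\<^sup>2"
      using sm bd by (intro suminf_le_const)
    hence "ip_norm (H2_inner w) (X m - f) \<le> sqrt (e\<^sup>2)"
      unfolding H2_norm[OF mem] by (rule real_sqrt_le_mono)
    thus ?thesis using mem e by simp
  qed
  obtain N where "\<And>n. n \<ge> N \<Longrightarrow> ip_norm (H2_inner w) (X N - X n) < 1"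
    using Cauchy[of 1] by auto
  hence "X N - f \<in> H2 w" using key[of 1 N N] by simp
  hence "f \<in> H2 w" using H2_diff[OF X[of N]] by fastforce
  moreover have "(\<lambda>i. ip_norm (H2_inner w) (X i - f)) \<longlonglongrightarrow> 0"
  proof (rule LIMSEQ_I)
    fix r :: real assume r: "r > 0"
    then obtain N where N: "\<And>m n. m \<ge> N \<Longrightarrow> n \<ge> N \<Longrightarrow> ip_norm (H2_inner w) (X m - X n) < r / 2"
      using Cauchy[of "r / 2"] by auto
    have "norm (ip_norm (H2_inner w) (X m - f) - 0) < r" if "m \<ge> N" for m
    proof -
      have k: "X m - f \<in> H2 w" "ip_norm (H2_inner w) (X m - f) \<le> r / 2"
        using key[of "r / 2" N m] N[OF that] r by auto
      have "0 \<le> ip_norm (H2_inner w) (X m - f)"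
        using k(1) w_pos by (simp add: H2_norm H2_def suminf_nonneg less_imp_le)
      thus ?thesis using k(2) r by simp
    qed
    thus "\<exists>no. \<forall>n\<ge>no. norm (ip_norm (H2_inner w) (X n - f) - 0) < r"
      by blast
  qed
  ultimately show ?thesis by blast
qed

lemma H2_hilbert_space: "complex_hilbert_space fps_scale (H2 w) (H2_inner w)"
proof -
  interpret vector_space fps_scale by (rule vector_space_fps_scale)
  show ?thesis
  proof unfold_locales
    show "subspace (H2 w)"
      by (auto simp: subspace_def H2_zero H2_add H2_scale)
  next
    fix x y z assume "x \<in> H2 w" "y \<in> H2 w" "z \<in> H2 w"
    thus "H2_inner w (x + y) z = H2_inner w x z + H2_inner w y z"
      by (simp add: H2_inner_def suminf_add H2_inner_summable distrib_right)
  next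
    fix x y c assume "x \<in> H2 w" "y \<in> H2 w"
    thus "H2_inner w (fps_scale c x) y = c * H2_inner w x y"
      using suminf_mult[OF H2_inner_summable] by (simp add: H2_inner_def mult.assoc)
  next
    fix x y assume "x \<in> H2 w" "y \<in> H2 w"
    thus "H2_inner w y x = cnj (H2_inner w x y)"
      using bounded_linear.suminf[OF bounded_linear_cnj H2_inner_summable]
      by (simp add: H2_inner_def mult_ac)
  next
    fix x assume x: "x \<in> H2 w"
    have nn: "0 \<le> (cmod (fps_nth x j))\<^sup>2 * w j" for j
      using w_pos[of j] by simp
    show "H2_inner w x x \<in> \<real>\<^sub>\<ge>\<^sub>0"
      using x nn by (simp add: H2_inner_self H2_def suminf_nonneg)
    assume "H2_inner w x x = 0"
    hence "(\<Sum>j. (cmod (fps_nth x j))\<^sup>2 * w j) = 0"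
      using x by (simp add: H2_inner_self)
    hence "\<forall>j. (cmod (fps_nth x j))\<^sup>2 * w j = 0"
      using x nn by (subst (asm) suminf_eq_zero_iff) (auto simp: H2_def)
    thus "x = 0"
      using w_pos by (auto simp: fps_eq_iff less_le)
  qed (rule H2_complete)
qed

text \<open>
  Under the growth condition on \<open>w\<close>, the elements of \<open>H2 w\<close> are
  holomorphic functions on the unit disc.
\<close>

lemma H2_conv_radius:
  assumes lim: "liminf (\<lambda>j. ereal (\<bar>w j\<bar> powr (1 / real j))) = 1"
    and f: "f \<in> H2 w"
  shows "fps_conv_radius f \<ge> 1"
  unfolding fps_conv_radius_def
proof (rule conv_radius_geI_ex)
  fix r :: real assume r: "0 < r" "ereal r < 1"
  then obtain s where s: "r < s" "s < 1"
    using dense[of r 1] by auto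
  have "ereal (s\<^sup>2) < 1"
    using r s power_Suc_less_one[of s 1] by (simp add: power2_eq_square)
  hence "\<forall>\<^sub>F j in sequentially. ereal (s\<^sup>2) < ereal (\<bar>w j\<bar> powr (1 / real j))"
    by (intro less_LiminfD) (simp add: lim)
  hence ev: "\<forall>\<^sub>F j in sequentially. (s ^ j)\<^sup>2 \<le> w j"
    using eventually_gt_at_top[of 0]
  proof eventually_elim
    case (elim j)
    have "(s\<^sup>2) ^ j \<le> (w j powr (1 / real j)) ^ j"
      using elim w_pos[of j] r s by (intro power_mono) auto
    also have "\<dots> = w j"
      using elim w_pos[of j] by (simp add: powr_powr flip: powr_realpow)
    finally show ?case by (simp add: power_mult [symmetric] mult.commute)
  qed
  have "summable (\<lambda>j. (cmod (fps_nth f j))\<^sup>2 * w j)"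
    using f by (simp add: H2_def)
  then obtain M where M: "M > 0" "\<And>j. norm ((cmod (fps_nth f j))\<^sup>2 * w j) \<le> M"
    using summable_imp_Bseq[THEN BseqD] by blast
  have "\<forall>\<^sub>F j in sequentially. norm (fps_nth f j * of_real r ^ j) \<le> sqrt M * (r / s) ^ j"
    using ev
  proof eventually_elim
    case (elim j)
    have "(cmod (fps_nth f j) * s ^ j)\<^sup>2 \<le> (cmod (fps_nth f j))\<^sup>2 * w j"
      using elim by (simp add: power_mult_distrib mult_left_mono)
    also have "\<dots> \<le> M"
      using M(2)[of j] by simp
    finally have "cmod (fps_nth f j) * s ^ j \<le> sqrt M"
      by (rule real_le_rsqrt)
    from mult_right_mono[OF this, of "(r / s) ^ j"] show ?case
      using r s by (simp add: norm_mult norm_power power_divide)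
  qed
  moreover have "summable (\<lambda>j. sqrt M * (r / s) ^ j)"
    using r s by (intro summable_mult summable_geometric) simp
  ultimately have "summable (\<lambda>j. fps_nth f j * of_real r ^ j)"
    by (rule summable_comparison_test_ev)
  thus "\<exists>z. norm z = r \<and> summable (\<lambda>j. fps_nth f j * z ^ j)"
    using r by (intro exI[of _ "of_real r"]) simp
qed

lemma H2_inner_forward_shift:
  assumes "forward_shift f \<in> H2 w" "g \<in> H2 w"
  shows "H2_inner w (forward_shift f) g = H2_inner w f (backward_shift w g)"
proof -
  have "H2_inner w (forward_shift f) g =
      (\<Sum>j. fps_nth f j * cnj (fps_nth g (Suc j)) * complex_of_real (w (Suc j)))"
    unfolding H2_inner_def
    using suminf_split_head[OF H2_inner_summable[OF assms]] by (simp add: forward_shift_nth)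
  also have "\<dots> = H2_inner w f (backward_shift w g)"
    unfolding H2_inner_def
    by (intro suminf_cong) (use w_pos in \<open>auto simp: less_le\<close>)
  finally show ?thesis .
qed

context
  assumes w_bdd: "bdd_above (range (\<lambda>j. w (Suc j) / w j))"
begin

lemma ratio_bound:
  obtains C where "C > 0" "\<And>j. w (Suc j) \<le> C * w j"
proof -
  obtain C where C: "\<And>j. w (Suc j) / w j \<le> C"
    using w_bdd by (auto simp: bdd_above_def)
  have "0 < w (Suc 0) / w 0" using w_pos by simp
  with C[of 0] have "C > 0" by linarith
  with C that show ?thesis
    using w_pos by (simp add: pos_divide_le_eq)
qed

lemma backward_shift_norm_aux:
  assumes "f \<in> H2 w" "C > 0" "\<And>j. w (Suc j) \<le> C * w j"
  shows "backward_shift w f \<in> H2 w"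
    and "(\<Sum>j. (cmod (fps_nth (backward_shift w f) j))\<^sup>2 * w j) \<le> C * (\<Sum>j. (cmod (fps_nth f j))\<^sup>2 * w j)"
proof -
  let ?a = "\<lambda>j. (cmod (fps_nth f j))\<^sup>2 * w j"
  let ?b = "\<lambda>j. (cmod (fps_nth (backward_shift w f) j))\<^sup>2 * w j"
  have a: "summable ?a" using assms by (simp add: H2_def)
  hence sa: "summable (\<lambda>j. C * ?a (Suc j))"
    using summable_Suc_iff[of ?a] by (intro summable_mult) simp
  have le: "?b j \<le> C * ?a (Suc j)" for j
  proof -
    have w: "w j > 0" "w (Suc j) > 0" using w_pos by auto
    have "?b j = w (Suc j) / w j * ?a (Suc j)"
      using w by (simp add: norm_mult norm_divide power_mult_distrib power2_eq_square field_simps)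
    also have "\<dots> \<le> C * ?a (Suc j)"
      using w assms(3)[of j] by (intro mult_right_mono) (auto simp: pos_divide_le_eq)
    finally show ?thesis .
  qed
  have nn: "0 \<le> ?b j" for j using w_pos[of j] by simp
  have sb: "summable ?b"
    by (rule summable_comparison_test'[OF sa]) (use le nn in auto)
  thus "backward_shift w f \<in> H2 w" by (simp add: H2_def)
  have "suminf ?b \<le> (\<Sum>j. C * ?a (Suc j))"
    by (rule suminf_le[OF le sb sa])
  also have "\<dots> = C * (\<Sum>j. ?a (Suc j))"
    using a summable_Suc_iff[of ?a] by (intro suminf_mult) simp
  also have "\<dots> \<le> C * suminf ?a"
    using assms(2) w_pos[of 0] suminf_split_head[OF a] by (intro mult_left_mono) auto
  finally show "suminf ?b \<le> C * suminf ?a" .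
qed

lemma forward_shift_norm_aux:
  assumes "f \<in> H2 w" "C > 0" "\<And>j. w (Suc j) \<le> C * w j"
  shows "forward_shift f \<in> H2 w"
    and "(\<Sum>j. (cmod (fps_nth (forward_shift f) j))\<^sup>2 * w j) \<le> C * (\<Sum>j. (cmod (fps_nth f j))\<^sup>2 * w j)"
proof -
  let ?a = "\<lambda>j. (cmod (fps_nth f j))\<^sup>2 * w j"
  let ?b = "\<lambda>j. (cmod (fps_nth (forward_shift f) j))\<^sup>2 * w j"
  have a: "summable ?a" using assms by (simp add: H2_def)
  hence sa: "summable (\<lambda>j. C * ?a j)" by (rule summable_mult)
  have le: "?b (Suc j) \<le> C * ?a j" for j
    using mult_left_mono[OF assms(3)[of j], of "(cmod (fps_nth f j))\<^sup>2"]
    by (simp add: forward_shift_nth mult_ac)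
  have nn: "0 \<le> ?b j" for j using w_pos[of j] by simp
  have sb': "summable (\<lambda>j. ?b (Suc j))"
    by (rule summable_comparison_test'[OF sa]) (use le nn in auto)
  hence sb: "summable ?b" using summable_Suc_iff[of ?b] by simp
  thus "forward_shift f \<in> H2 w" by (simp add: H2_def)
  have "suminf ?b = (\<Sum>j. ?b (Suc j))"
    using suminf_split_head[OF sb] by (simp add: forward_shift_nth)
  also have "\<dots> \<le> (\<Sum>j. C * ?a j)"
    by (rule suminf_le[OF le sb' sa])
  also have "\<dots> = C * suminf ?a"
    using a by (rule suminf_mult)
  finally show "suminf ?b \<le> C * suminf ?a" .
qed

lemma backward_shift_bounded:
  "bounded_operator_on fps_scale (H2 w) (H2_inner w) (backward_shift w)"
proof -
  obtain C where C: "C > 0" "\<And>j. w (Suc j) \<le> C * w j" by (rule ratio_bound) blast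
  have "ip_norm (H2_inner w) (backward_shift w f) \<le> sqrt C * ip_norm (H2_inner w) f"
    if "f \<in> H2 w" for f
    using backward_shift_norm_aux[OF that C] that
    by (simp only: H2_norm real_sqrt_le_mono flip: real_sqrt_mult)
  thus ?thesis
    unfolding bounded_operator_on_def
    using backward_shift_norm_aux(1)[OF _ C]
    by (auto simp: fps_eq_iff algebra_simps)
qed

lemma forward_shift_bounded:
  "bounded_operator_on fps_scale (H2 w) (H2_inner w) forward_shift"
proof -
  obtain C where C: "C > 0" "\<And>j. w (Suc j) \<le> C * w j" by (rule ratio_bound) blast
  have "ip_norm (H2_inner w) (forward_shift f) \<le> sqrt C * ip_norm (H2_inner w) f"
    if "f \<in> H2 w" for f
    using forward_shift_norm_aux[OF that C] that
    by (simp only: H2_norm real_sqrt_le_mono flip: real_sqrt_mult)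
  thus ?thesis
    unfolding bounded_operator_on_def
    using forward_shift_norm_aux(1)[OF _ C]
    by (auto simp: fps_eq_iff forward_shift_nth)
qed

lemma adjoint_on_eqI:
  assumes S: "\<And>y. y \<in> H2 w \<Longrightarrow> S y \<in> H2 w"
    and adj: "\<And>x y. x \<in> H2 w \<Longrightarrow> y \<in> H2 w \<Longrightarrow> H2_inner w (T x) y = H2_inner w x (S y)"
    and g: "g \<in> H2 w"
  shows "adjoint_on (H2 w) (H2_inner w) T g = S g"
proof -
  interpret complex_hilbert_space fps_scale "H2 w" "H2_inner w"
    by (rule H2_hilbert_space)
  let ?A = "adjoint_on (H2 w) (H2_inner w) T"
  have A: "(\<forall>y\<in>H2 w. ?A y \<in> H2 w) \<and>
      (\<forall>x\<in>H2 w. \<forall>y\<in>H2 w. H2_inner w (T x) y = H2_inner w x (?A y))"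
    unfolding adjoint_on_def by (rule someI[of _ S]) (use S adj in blast)
  define d where "d = ?A g - S g"
  have mem: "?A g \<in> H2 w" "S g \<in> H2 w" "d \<in> H2 w"
    using A S g H2_diff by (auto simp: d_def)
  have "H2_inner w d (?A g) = H2_inner w (T d) g"
    using A g mem(3) by simp
  also have "\<dots> = H2_inner w d (S g)"
    by (rule adj[OF mem(3) g])
  finally have "H2_inner w (?A g) d = H2_inner w (S g) d"
    using ip_cnj[OF mem(3) mem(1)] ip_cnj[OF mem(3) mem(2)] by simp
  moreover have "H2_inner w (?A g) d = H2_inner w d d + H2_inner w (S g) d"
    using ip_add[of d "S g" d] mem by (simp add: d_def)
  ultimately have "d = 0"
    using ip_definite mem by simp
  thus ?thesis by (simp add: d_def)
qed

lemma adjoint_forward_shift: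
  assumes "g \<in> H2 w"
  shows "adjoint_on (H2 w) (H2_inner w) forward_shift g = backward_shift w g"
  using backward_shift_bounded forward_shift_bounded assms
  by (intro adjoint_on_eqI H2_inner_forward_shift) (auto simp: bounded_operator_on_def)

lemma adjoint_backward_shift:
  assumes "g \<in> H2 w"
  shows "adjoint_on (H2 w) (H2_inner w) (backward_shift w) g = forward_shift g"
proof (rule adjoint_on_eqI)
  interpret complex_hilbert_space fps_scale "H2 w" "H2_inner w"
    by (rule H2_hilbert_space)
  have mem: "forward_shift f \<in> H2 w" "backward_shift w f \<in> H2 w" if "f \<in> H2 w" for f
    using backward_shift_bounded forward_shift_bounded that
    by (auto simp: bounded_operator_on_def)
  show "forward_shift y \<in> H2 w" if "y \<in> H2 w" for y
    using mem that by blast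
  show "H2_inner w (backward_shift w x) y = H2_inner w x (forward_shift y)"
    if x: "x \<in> H2 w" and y: "y \<in> H2 w" for x y
    using H2_inner_forward_shift[OF mem(1)[OF y] x]
      ip_cnj[OF mem(1)[OF y] x] ip_cnj[OF y mem(2)[OF x]] by simp
qed (fact assms)

end

end

end

theory Submission
  imports Defs
begin

text \<open>
  Let \<open>T\<close> be the backward shift and \<open>U = (\<Sum>m. x\<^sup>m / w m)\<close>, a formal power series.
  Each \<open>(T\<^sup>*)\<^sup>j T\<^sup>j\<close> is diagonal in the monomials: it multiplies \<open>z\<^sup>m\<close> by \<open>w m / w (m - j)\<close>
  if \<open>j \<le> m\<close> and by \<open>0\<close> otherwise.  Hence the alternating sum in the definition of a
  hypercontraction multiplies \<open>z\<^sup>m\<close> by \<open>w m\<close> times the \<open>m\<close>-th coefficient of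
  \<open>(1 - x)\<^sup>n U\<close>, as expanding \<open>(1 - x)\<^sup>n\<close> shows (lemma \<open>hereditary_sum_nth\<close>).  Testing the
  positivity condition on \<open>z\<^sup>m\<close> for every \<open>m\<close> says that \<open>c = (1 - x)\<^sup>n U\<close> has nonnegative
  coefficients (lemma \<open>hypercontraction_imp_coeffs_nonneg\<close>).

  It remains to see that the coefficients \<open>u\<close> of \<open>U = c / (1 - x)\<^sup>n\<close> grow at least as
  fast as those of the extremal case \<open>1 / (1 - x)\<^sup>n\<close>, that is,
  \<open>(j + 1) u (j + 1) \<ge> (n + j) u j\<close>.  Differentiating \<open>U\<close> gives
  \<open>(1 - x) U' - n U = c' / (1 - x)\<^bsup>n-1\<^esup>\<close>.  The \<open>j\<close>-th coefficient on the left is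
  \<open>(j + 1) u (j + 1) - (n + j) u j\<close>, and the series on the right has nonnegative
  coefficients because \<open>n \<ge> 1\<close> (lemma \<open>coeff_growth_of_nonneg_differences\<close>).
\<close>

lemma fps_nonneg_mult:
  fixes f g :: "'a :: linordered_semidom fps"
  assumes "\<And>i. fps_nth f i \<ge> 0" "\<And>i. fps_nth g i \<ge> 0"
  shows "fps_nth (f * g) i \<ge> 0"
  by (simp add: fps_mult_nth sum_nonneg assms)

lemma fps_nonneg_power:
  fixes f :: "'a :: linordered_semidom fps"
  assumes "\<And>i. fps_nth f i \<ge> 0"
  shows "fps_nth (f ^ k) i \<ge> 0"
  by (induction k arbitrary: i) (simp_all add: fps_nonneg_mult assms)

lemma one_minus_X_power_mult_nth:
  fixes U :: "'a :: comm_ring_1 fps"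
  shows "fps_nth ((1 - fps_X) ^ k * U) i =
    (\<Sum>j\<le>k. (- 1) ^ j * of_nat (k choose j) * (if i < j then 0 else fps_nth U (i - j)))"
proof -
  have "(1 - fps_X :: 'a fps) ^ k = (- fps_X + 1) ^ k"
    by simp
  also have "\<dots> = (\<Sum>j\<le>k. fps_const ((- 1) ^ j * of_nat (k choose j)) * fps_X ^ j)"
    unfolding binomial_ring
    by (intro sum.cong refl)
      (simp add: power_minus[of fps_X] fps_of_nat mult_ac
        flip: fps_const_mult fps_const_power fps_const_neg)
  finally show ?thesis
    by (simp add: sum_distrib_right fps_sum_nth mult.assoc fps_X_power_mult_nth)
qed

text \<open>
  With \<open>V = 1 / (1 - x)\<close> one has \<open>V' = V\<^sup>2\<close>, so \<open>U = c V\<^sup>n\<close> satisfies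
  \<open>(1 - x) U' = c' V\<^bsup>n-1\<^esup> + n U\<close>, and both \<open>c'\<close> and \<open>V\<close> have nonnegative coefficients.
\<close>

lemma coeff_growth_of_nonneg_differences:
  fixes U :: "'a :: linordered_field fps"
  assumes n: "n \<ge> 1"
    and nonneg: "\<And>i. fps_nth ((1 - fps_X) ^ n * U) i \<ge> 0"
  shows "of_nat (n + j) * fps_nth U j \<le> of_nat (Suc j) * fps_nth U (Suc j)"
proof -
  define V :: "'a fps" where "V = Abs_fps (\<lambda>_. 1)"
  define c where "c = (1 - fps_X) ^ n * U"
  obtain m where m: "n = Suc m"
    using n by (cases n) auto
  have V: "(1 - fps_X) * V = 1"
    by (rule fps_ext) (simp add: V_def left_diff_distrib)
  have "fps_deriv ((1 - fps_X) * V) = 0"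
    by (simp add: V)
  hence V': "(1 - fps_X) * fps_deriv V = V"
    by (simp add: algebra_simps)
  have U: "U = c * V ^ n"
  proof -
    have "c * V ^ n = ((1 - fps_X) * V) ^ n * U"
      by (simp add: c_def power_mult_distrib mult_ac)
    thus ?thesis by (simp add: V)
  qed
  have dVn: "fps_deriv (V ^ n) = of_nat n * (fps_deriv V * V ^ m)"
    unfolding m fps_deriv_power' by (simp add: mult_ac)
  have Vn: "V ^ n = V * V ^ m"
    by (simp add: m)
  have "fps_deriv U = V * (fps_deriv c * V ^ m) + of_nat n * (fps_deriv V * (c * V ^ m))"
    unfolding U fps_deriv_mult dVn unfolding Vn by (simp only: ac_simps)
  hence "(1 - fps_X) * fps_deriv U =
      ((1 - fps_X) * V) * (fps_deriv c * V ^ m)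
      + of_nat n * (((1 - fps_X) * fps_deriv V) * (c * V ^ m))"
    by (simp only: distrib_left mult_ac)
  also have "\<dots> = fps_deriv c * V ^ m + of_nat n * U"
    unfolding V V' unfolding U Vn by (simp only: mult_1_left ac_simps)
  finally have "(1 - fps_X) * fps_deriv U - of_nat n * U = fps_deriv c * V ^ m"
    by simp
  hence "fps_nth ((1 - fps_X) * fps_deriv U - of_nat n * U) j = fps_nth (fps_deriv c * V ^ m) j"
    by simp
  moreover have "fps_nth (fps_deriv c * V ^ m) j \<ge> 0"
    using nonneg[folded c_def]
    by (intro fps_nonneg_mult fps_nonneg_power) (simp_all add: V_def)
  moreover have "fps_nth ((1 - fps_X) * fps_deriv U - of_nat n * U) j =
      of_nat (Suc j) * fps_nth U (Suc j) - of_nat (n + j) * fps_nth U j"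
    by (cases j) (simp_all add: left_diff_distrib algebra_simps flip: fps_of_nat)
  ultimately show ?thesis by simp
qed

lemma backward_shift_power_nth:
  assumes w: "\<And>j. w j > 0"
  shows "fps_nth ((backward_shift w ^^ j) f) i = complex_of_real (w (i + j) / w i) * fps_nth f (i + j)"
proof (induction j arbitrary: i)
  case 0
  show ?case using w[of i] by simp
next
  case (Suc j)
  show ?case using w[of "Suc i"] by (simp add: Suc)
qed

lemma adjoint_backward_shift_power:
  assumes w: "\<And>j. w j > 0"
    and bdd: "bdd_above (range (\<lambda>j. w (Suc j) / w j))"
    and g: "g \<in> H2 w"
  shows "(adjoint_on (H2 w) (H2_inner w) (backward_shift w) ^^ j) g = fps_X ^ j * g"
    and "fps_X ^ j * g \<in> H2 w"
proof (induction j)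
  case 0
  { case 1 show ?case by simp }
  { case 2 show ?case using g by simp }
next
  case (Suc j)
  { case 1 show ?case
      using adjoint_backward_shift[OF w bdd Suc(2)]
      by (simp add: Suc forward_shift_def mult_ac) }
  { case 2 show ?case
      using forward_shift_bounded[OF w bdd] Suc(2)
      by (simp add: bounded_operator_on_def forward_shift_def mult.assoc) }
qed

text \<open>
  The operator \<open>(T\<^sup>*)\<^sup>j T\<^sup>j\<close> moves the \<open>i\<close>-th coefficient down and up again, picking up the
  weight \<open>w i / w (i - j)\<close>, or annihilates it if \<open>i < j\<close>; summing over \<open>j\<close> is a binomial
  convolution with \<open>1 / w\<close>.
\<close>

lemma hereditary_sum_nth:
  assumes w: "\<And>j. w j > 0"
    and bdd: "bdd_above (range (\<lambda>j. w (Suc j) / w j))"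
    and f: "f \<in> H2 w"
  shows "fps_nth (\<Sum>j\<le>k. fps_scale ((- 1) ^ j * of_nat (k choose j))
            ((adjoint_on (H2 w) (H2_inner w) (backward_shift w) ^^ j)
              ((backward_shift w ^^ j) f))) i =
         complex_of_real (w i * fps_nth ((1 - fps_X) ^ k * Abs_fps (\<lambda>m. 1 / w m)) i) * fps_nth f i"
proof -
  have mem: "(backward_shift w ^^ j) f \<in> H2 w" for j
    using backward_shift_bounded[OF w bdd] f
    by (induction j) (auto simp: bounded_operator_on_def)
  have "fps_nth ((adjoint_on (H2 w) (H2_inner w) (backward_shift w) ^^ j)
          ((backward_shift w ^^ j) f)) i =
        complex_of_real (w i * (if i < j then 0 else 1 / w (i - j))) * fps_nth f i" for j
    by (simp add: adjoint_backward_shift_power[OF w bdd mem] fps_X_power_mult_nth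
        backward_shift_power_nth[OF w])
  thus ?thesis
    unfolding one_minus_X_power_mult_nth fps_sum_nth
    by (simp add: sum_distrib_left sum_distrib_right mult_ac cong: if_cong)
qed

text \<open>
  The operator being diagonal, its value on the monomial \<open>z\<^sup>i\<close> already determines the sign of
  the \<open>i\<close>-th coefficient: \<open>w i > 0\<close> enters twice, from the operator and from \<open>\<parallel>z\<^sup>i\<parallel>\<^sup>2\<close>.
\<close>

lemma hypercontraction_imp_coeffs_nonneg:
  assumes w: "\<And>j. w j > 0"
    and bdd: "bdd_above (range (\<lambda>j. w (Suc j) / w j))"
    and hyp: "hypercontraction n fps_scale (H2 w) (H2_inner w) (backward_shift w)"
    and k: "1 \<le> k" "k \<le> n"
  shows "fps_nth ((1 - fps_X) ^ k * Abs_fps (\<lambda>m. 1 / w m)) i \<ge> 0" (is "?c \<ge> 0")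
proof -
  define A where "A = (\<lambda>f. \<Sum>j\<le>k. fps_scale ((- 1) ^ j * of_nat (k choose j))
            ((adjoint_on (H2 w) (H2_inner w) (backward_shift w) ^^ j)
              ((backward_shift w ^^ j) f)))"
  have mem: "fps_X ^ i \<in> H2 w"
    unfolding H2_def
    by (auto intro!: summable_finite[of "{i}"] split: if_splits)
  have "H2_inner w (A (fps_X ^ i)) (fps_X ^ i) = complex_of_real (w i * ?c * w i)"
    unfolding H2_inner_def A_def hereditary_sum_nth[OF w bdd mem]
    by (subst suminf_finite[of "{i}"]) auto
  moreover have "H2_inner w (A (fps_X ^ i)) (fps_X ^ i) \<in> \<real>\<^sub>\<ge>\<^sub>0"
    using hyp k mem by (auto simp: hypercontraction_def positive_operator_on_def A_def)
  ultimately have "w i * ?c * w i \<ge> 0"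
    by (metis nonneg_Reals_of_real_iff)
  thus ?thesis
    using w[of i] by (simp add: zero_le_mult_iff)
qed

theorem theorem1p1:
  fixes w :: "nat \<Rightarrow> real" and n :: nat
  assumes "\<And>j. w j > 0"
    and "liminf (\<lambda>j. ereal (\<bar>w j\<bar> powr (1 / real j))) = 1"
    and "bdd_above (range (\<lambda>j. w (Suc j) / w j))"
    and "n \<ge> 1"
    and "hypercontraction n fps_scale (H2 w) (H2_inner w) (backward_shift w)"
  shows "\<forall>j. w (Suc j) / w j \<le> (1 + real j) / (real n + real j)"
proof
  fix j
  have "real (n + j) * (1 / w j) \<le> real (Suc j) * (1 / w (Suc j))"
    using coeff_growth_of_nonneg_differences[OF assms(4)
        hypercontraction_imp_coeffs_nonneg[OF assms(1,3,5,4) order_refl], of j]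
    by simp
  thus "w (Suc j) / w j \<le> (1 + real j) / (real n + real j)"
    using assms(1)[of j] assms(1)[of "Suc j"] assms(4) by (simp add: field_simps)
qed

end
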